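(* Every sequence $(x_k)_{k\in\mathbb{N}}$ generated by tPLDCA satisfies: (a) the sequence $\left(f(x_k)+\left(\frac{\gamma}{2}+\rho\right)\|x_k-x_{k-1}\|^2\right)_{k\in\mathbb{N}}$ is decreasing; (b) $\lim_{k\to+\infty}\|x_{k+1}-x_k\|=0$; (c) $(f(x_k))_{k\in\mathbb{N}}$ is convergent.
   Context: "Decreasing" is meant in the non-strict sense (each term is $\ge$ the next). Notation: $\mathbb{N}=\{0,1,2,\dots\}$; $\langle\cdot,\cdot\rangle$ and $\|\cdot\|$ are the inner product and Euclidean norm on $\mathbb{R}^n$. $\Gamma_0(\mathbb{R}^n)$ is the set of proper, lower semicontinuous, convex functions $\mathbb{R}^n\to\mathbb{R}\cup\{+\infty\}$; $\mathrm{dom}\,\phi=\{x:\phi(x)<+\infty\}$. For $\phi\in\Gamma_0(\mathbb{R}^n)$, $x\in\mathrm{dom}\,\phi$, $\epsilon>0$: $\partial\phi(x)=\{s:\phi(y)\ge\phi(x)+\langle s,y-x\rangle\ \forall y\in\mathbb{R}^n\}$ and $\partial_\epsilon\phi(x)=\{s:\phi(y)\ge\phi(x)+\langle s,y-x\rangle-\epsilon\ \forall y\in\mathbb{R}^n\}$; for $\epsilon=0$, $\partial_0\phi=\partial\phi$. For a nonempty closed set $S$, $\mathrm{dist}(x,S)=\min_{y\in S}\|x-y\|$. Standing assumptions: $g,h\in\Gamma_0(\mathbb{R}^n)$, $f=g-h$, and (1) $\inf_{x\in\mathbb{R}^n} f(x)>-\infty$; (2) $\mathrm{dom}\,h=\mathbb{R}^n$;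 (3) $g=g_0+\iota_C$, where $g_0\in\Gamma_0(\mathbb{R}^n)$ has $\mathrm{dom}\,g_0=\mathbb{R}^n$, $C\subset\mathbb{R}^n$ is nonempty closed convex, and $\iota_C$ is $0$ on $C$ and $+\infty$ elsewhere; (4) there is an inner iterative algorithm $T_g$ such that for any $(x_k,u_k,\lambda_k)\in\mathrm{dom}\,g\times\mathbb{R}^n\times(0,\infty)$, $T_g(x_k,u_k,\lambda_k)$ generates a sequence $(z_i)_{i\in\mathbb{N}}$ in $\mathrm{dom}\,g$ converging to a solution $\bar z_k\in\mathrm{dom}\,g$ of the proximal point subproblem (PP): minimize over $z\in\mathbb{R}^n$ the function $\tilde f_k(z)=g(z)-\langle u_k,z-x_k\rangle+\frac{1}{2\lambda_k}\|z-x_k\|^2$; i.e. $0\in\partial\tilde f_k(\bar z_k)=\partial g(\bar z_k)-u_k+\frac{1}{\lambda_k}(\bar z_k-x_k)$. Algorithm tPLDCA. Parameters: $\sigma\in(0,1)$, $\lambda>0$, $\theta>\frac1\lambda$, $\rho\in[0,\frac{1-\sigma}{\lambda})$, $\gamma\in[0,\frac{1-\sigma}{\lambda}-\rho)$, $\lambda_k=\lambda$ for all $k\in\mathbb{N}$, and positive numbers $(\zeta_k)_{k\in\mathbb{N}}$ with $\zeta_k\to0$. Start with $x_{-1},x_0\in\mathrm{dom}\,f=\{x:f(x)<+\infty\}$ and for $k=0,1,2,\dots$ do: Step 1: find $u_k\in\mathbb{R}^n$ with $\mathrm{dist}(u_k,\partial_{\epsilon_k}h(x_k))\le d_k$, where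 $\epsilon_k=\rho\|x_k-x_{k-1}\|^2$ and $d_k=\gamma\|x_k-x_{k-1}\|$. Step 2: set $z_{-1}=x_k$ and generate $z_0,z_1,\dots$ by $T_g(x_k,u_k,\lambda_k)$ until, for some $i\in\{-1\}\cup\mathbb{N}$, both $g(x_k)-g(z_i)-\langle u_k,x_k-z_i\rangle\ge\frac{1-\sigma}{\lambda_k}\|z_i-x_k\|^2$ and $\mathrm{dist}(u_k,\partial_{\zeta_k}g(z_i))\le\theta\|z_i-x_k\|$ hold; then set $x_{k+1}=z_i$. *)

theory Defs
  imports "HOL-Analysis.Analysis"
begin

definition edom :: "('a \<Rightarrow> ereal) \<Rightarrow> 'a set" where
  "edom \<phi> = {x. \<phi> x < \<infinity>}"

definition proper_fun :: "('a \<Rightarrow> ereal) \<Rightarrow> bool" where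
  "proper_fun \<phi> \<longleftrightarrow> (\<forall>x. \<phi> x \<noteq> - \<infinity>) \<and> edom \<phi> \<noteq> {}"

definition lsc_fun :: "('a::topological_space \<Rightarrow> ereal) \<Rightarrow> bool" where
  "lsc_fun \<phi> \<longleftrightarrow> (\<forall>x. \<phi> x \<le> Liminf (at x) \<phi>)"

text \<open>Only used for functions that never take the value \<open>- \<infinity>\<close>, so the right-hand
  side never has the form \<open>\<infinity> - \<infinity>\<close>; for a zero weight, \<open>0 * \<infinity> = 0\<close> in \<open>ereal\<close>.\<close>

definition convex_fun :: "('a::real_vector \<Rightarrow> ereal) \<Rightarrow> bool" where
  "convex_fun \<phi> \<longleftrightarrow>
     (\<forall>x y. \<forall>s\<ge>0. \<forall>t\<ge>0. s + t = 1 \<longrightarrow>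
        \<phi> (s *\<^sub>R x + t *\<^sub>R y) \<le> ereal s * \<phi> x + ereal t * \<phi> y)"

definition Gamma0 :: "('a::euclidean_space \<Rightarrow> ereal) set" where
  "Gamma0 = {\<phi>. proper_fun \<phi> \<and> lsc_fun \<phi> \<and> convex_fun \<phi>}"

definition indicator_inf :: "'a set \<Rightarrow> 'a \<Rightarrow> ereal" where
  "indicator_inf C x = (if x \<in> C then 0 else \<infinity>)"

text \<open>The case \<open>\<epsilon> = 0\<close> is the exact subdifferential. For a proper \<open>\<phi>\<close> and \<open>x \<notin> edom \<phi>\<close>
  the set is empty.\<close>

definition eps_subdiff :: "real \<Rightarrow> ('a::euclidean_space \<Rightarrow> ereal) \<Rightarrow> 'a \<Rightarrow> 'a set" where
  "eps_subdiff \<epsilon> \<phi> x = {s. \<forall>y. \<phi> y \<ge> \<phi> x + ereal (s \<bullet> (y - x)) - ereal \<epsilon>}"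

definition prox_objective ::
    "('a::euclidean_space \<Rightarrow> ereal) \<Rightarrow> 'a \<Rightarrow> 'a \<Rightarrow> real \<Rightarrow> 'a \<Rightarrow> ereal" where
  "prox_objective g x u l z =
     g z - ereal (u \<bullet> (z - x)) + ereal (1 / (2 * l) * (norm (z - x))\<^sup>2)"

definition prox_solution ::
    "('a::euclidean_space \<Rightarrow> ereal) \<Rightarrow> 'a \<Rightarrow> 'a \<Rightarrow> real \<Rightarrow> 'a \<Rightarrow> bool" where
  "prox_solution g x u l z \<longleftrightarrow>
     z \<in> edom g \<and> (\<forall>y. prox_objective g x u l z \<le> prox_objective g x u l y)"

text \<open>\<open>T x u l\<close> is the sequence \<open>z\<^sub>0, z\<^sub>1, \<dots>\<close> generated from the data \<open>(x, u, l)\<close>.\<close>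

definition inner_algorithm ::
    "('a::euclidean_space \<Rightarrow> ereal) \<Rightarrow> ('a \<Rightarrow> 'a \<Rightarrow> real \<Rightarrow> nat \<Rightarrow> 'a) \<Rightarrow> bool" where
  "inner_algorithm g T \<longleftrightarrow>
     (\<forall>x\<in>edom g. \<forall>u. \<forall>l>0.
        (\<forall>i. T x u l i \<in> edom g) \<and>
        (\<exists>z. prox_solution g x u l z \<and> T x u l \<longlonglongrightarrow> z))"

text \<open>The inner iterates with the additional start \<open>z\<^sub>-\<^sub>1 = x\<close>; only indices \<open>i \<ge> - 1\<close> are used.\<close>

definition inner_iterate ::
    "('a \<Rightarrow> 'a \<Rightarrow> real \<Rightarrow> nat \<Rightarrow> 'a) \<Rightarrow> 'a \<Rightarrow> 'a \<Rightarrow> real \<Rightarrow> int \<Rightarrow> 'a" where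
  "inner_iterate T x u l i = (if i < 0 then x else T x u l (nat i))"

text \<open>\<open>infdist\<close> is the distance to a nonempty set (and \<open>0\<close> for the empty set). The sets it is
  applied to below are nonempty: the \<open>\<epsilon>\<close>-subdifferential of an everywhere finite convex
  function with \<open>\<epsilon> \<ge> 0\<close>, and that of a member of \<open>Gamma0\<close> at a point of its domain
  with \<open>\<epsilon> > 0\<close>.\<close>

definition stopping_test ::
    "('a::euclidean_space \<Rightarrow> ereal) \<Rightarrow> real \<Rightarrow> real \<Rightarrow> real \<Rightarrow> real \<Rightarrow> 'a \<Rightarrow> 'a \<Rightarrow> 'a \<Rightarrow> bool" where
  "stopping_test g \<sigma> l \<theta> \<zeta> x u z \<longleftrightarrow>
     g x - g z - ereal (u \<bullet> (x - z)) \<ge> ereal ((1 - \<sigma>) / l * (norm (z - x))\<^sup>2) \<and>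
     infdist u (eps_subdiff \<zeta> g z) \<le> \<theta> * norm (z - x)"

text \<open>The outer iterates are indexed by integers \<open>\<ge> - 1\<close>, the values at smaller integers being
  irrelevant. The inner loop returns the first inner iterate that passes the test.\<close>

definition tPLDCA ::
    "('a::euclidean_space \<Rightarrow> ereal) \<Rightarrow> ('a \<Rightarrow> ereal) \<Rightarrow> ('a \<Rightarrow> 'a \<Rightarrow> real \<Rightarrow> nat \<Rightarrow> 'a) \<Rightarrow>
     real \<Rightarrow> real \<Rightarrow> real \<Rightarrow> real \<Rightarrow> real \<Rightarrow> (nat \<Rightarrow> real) \<Rightarrow> (int \<Rightarrow> 'a) \<Rightarrow> bool" where
  "tPLDCA g h T \<sigma> l \<theta> \<rho> \<gamma> \<zeta> x \<longleftrightarrow>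
     x (- 1) \<in> edom (\<lambda>y. g y - h y) \<and> x 0 \<in> edom (\<lambda>y. g y - h y) \<and>
     (\<forall>k::nat. \<exists>u.
        infdist u (eps_subdiff (\<rho> * (norm (x (int k) - x (int k - 1)))\<^sup>2) h (x (int k)))
          \<le> \<gamma> * norm (x (int k) - x (int k - 1)) \<and>
        (\<exists>i\<ge>- 1.
           stopping_test g \<sigma> l \<theta> (\<zeta> k) (x (int k)) u (inner_iterate T (x (int k)) u l i) \<and>
           (\<forall>j. - 1 \<le> j \<and> j < i \<longrightarrow>
              \<not> stopping_test g \<sigma> l \<theta> (\<zeta> k) (x (int k)) u (inner_iterate T (x (int k)) u l j)) \<and>
           x (int k + 1) = inner_iterate T (x (int k)) u l i))"

end

theory Submission
  imports Defs
begin

text \<open>By convexity of \<open>h\<close> the set \<open>\<partial>\<^sub>\<epsilon>h(x\<^sub>k)\<close> is nonempty and closed, so it contains some \<open>s\<close> with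
  \<open>\<parallel>u\<^sub>k - s\<parallel> \<le> d\<^sub>k\<close>. Adding the inequality defining \<open>s\<close>, taken at \<open>x\<^sub>k\<^sub>+\<^sub>1\<close>, to the first
  stopping inequality and writing \<open>\<Delta>\<^sub>k = \<parallel>x\<^sub>k - x\<^sub>k\<^sub>-\<^sub>1\<parallel>\<close>, \<open>c = (1 - \<sigma>) / \<lambda>\<close>, one gets
  \<open>f(x\<^sub>k) - f(x\<^sub>k\<^sub>+\<^sub>1) \<ge> c \<Delta>\<^sub>k\<^sub>+\<^sub>1\<^sup>2 - \<gamma> \<Delta>\<^sub>k \<Delta>\<^sub>k\<^sub>+\<^sub>1 - \<rho> \<Delta>\<^sub>k\<^sup>2\<close>. By AM-GM the energy
  \<open>f(x\<^sub>k) + (\<gamma>/2 + \<rho>) \<Delta>\<^sub>k\<^sup>2\<close> then drops by at least \<open>(c - \<rho> - \<gamma>) \<Delta>\<^sub>k\<^sub>+\<^sub>1\<^sup>2\<close> in each step; being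
  bounded below, it converges, and \<open>\<Delta>\<^sub>k\<close> tends to \<open>0\<close>.\<close>

text \<open>A hyperplane separates the point \<open>(x, \<phi> x)\<close> from the strict epigraph
  \<open>E\<close>. It is not vertical since \<open>\<phi>\<close> is finite everywhere, so its
  slope \<open>- p / q\<close> is a subgradient.\<close>

lemma subgradient_exists:
  fixes \<phi> :: "'a::euclidean_space \<Rightarrow> real"
  assumes "convex_on UNIV \<phi>"
  shows "\<exists>s. \<forall>y. \<phi> y \<ge> \<phi> x + s \<bullet> (y - x)"
proof -
  define E where "E = {(y, t). \<phi> y < t}"
  have "convex E"
    unfolding convex_def
  proof (intro ballI allI impI)
    fix p q and a b :: real
    assume p: "p \<in> E" and q: "q \<in> E" and ab: "0 \<le> a" "0 \<le> b" "a + b = 1"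
    obtain y t z r where pq: "p = (y, t)" "q = (z, r)" by (metis surj_pair)
    with p q have lt: "\<phi> y < t" "\<phi> z < r" by (auto simp: E_def)
    have "\<phi> (a *\<^sub>R y + b *\<^sub>R z) \<le> a * \<phi> y + b * \<phi> z"
      using assms ab unfolding convex_on_def by blast
    also have "\<dots> < a * t + b * r"
    \<comment> \<open>Strictness has to come from a positive weight: if \<open>a = 0\<close>, then
      \<open>b = 1\<close> supplies it.\<close>
    proof (cases "a = 0")
      case True
      then show ?thesis using ab lt by simp
    next
      case False
      then have "a * \<phi> y < a * t" using ab lt by simp
      moreover have "b * \<phi> z \<le> b * r" using ab lt by (simp add: mult_left_mono)
      ultimately show ?thesis by simp
    qed
    finally show "a *\<^sub>R p + b *\<^sub>R q \<in> E" by (simp add: E_def pq)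
  qed
  moreover have "(x, \<phi> x + 1) \<in> E" "E \<inter> {(x, \<phi> x)} = {}" by (auto simp: E_def)
  then have "E \<noteq> {}" "{(x, \<phi> x)} \<inter> E = {}" by auto
  ultimately obtain a b where ab: "a \<noteq> 0" "\<forall>w\<in>{(x, \<phi> x)}. a \<bullet> w \<le> b" "\<forall>w\<in>E. b \<le> a \<bullet> w"
    using separating_hyperplane_sets[of "{(x, \<phi> x)}" E] by (metis convex_singleton insert_not_empty)
  obtain p q where a: "a = (p, q)" by fastforce
  have *: "p \<bullet> x + q * \<phi> x \<le> p \<bullet> y + q * t" if "\<phi> y < t" for y t
    using that ab(2,3) by (fastforce simp: a E_def)
  have "q \<ge> 0" using *[of x "\<phi> x + 1"] by (simp add: algebra_simps)
  moreover have "q \<noteq> 0"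
  proof
    assume "q = 0"
    \<comment> \<open>A vertical hyperplane is refuted by stepping from \<open>x\<close> against its
      normal \<open>p\<close>: some point of \<open>E\<close> lies above
      \<open>x - p\<close>.\<close>
    then have "p \<bullet> p \<le> 0" using *[of "x - p" "\<phi> (x - p) + 1"] by (simp add: inner_diff_right)
    moreover have "p \<noteq> 0" using \<open>q = 0\<close> ab(1) a by (simp add: zero_prod_def)
    ultimately show False by (metis inner_gt_zero_iff not_less)
  qed
  ultimately have q: "q > 0" by simp
  have "\<phi> x + (- (1 / q) *\<^sub>R p) \<bullet> (y - x) \<le> \<phi> y" for y
  \<comment> \<open>\<open>E\<close> contains only heights strictly above the graph, so height
    \<open>\<phi> y\<close> is reached as a limit of \<open>\<phi> y + e\<close>.\<close>
  proof (rule field_le_epsilon)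
    fix e :: real assume "e > 0"
    then have "p \<bullet> x + q * \<phi> x \<le> p \<bullet> y + q * (\<phi> y + e)" by (intro *) simp
    then show "\<phi> x + (- (1 / q) *\<^sub>R p) \<bullet> (y - x) \<le> \<phi> y + e"
      using q by (simp add: field_simps inner_diff_right)
  qed
  then show ?thesis by blast
qed

lemma convex_on_real_of_convex_fun:
  assumes "convex_fun (\<lambda>y. ereal (\<phi> y))"
  shows "convex_on UNIV \<phi>"
  using assms unfolding convex_fun_def convex_on_def by simp

lemma mem_eps_subdiff_real:
  "s \<in> eps_subdiff \<epsilon> (\<lambda>y. ereal (\<phi> y)) x \<longleftrightarrow> (\<forall>y. \<phi> x + s \<bullet> (y - x) - \<epsilon> \<le> \<phi> y)"
  by (simp add: eps_subdiff_def)

text \<open>An intersection of closed half-spaces. Closedness lets \<open>infdist\<close> be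
  attained at an actual approximate subgradient.\<close>

lemma closed_eps_subdiff_real: "closed (eps_subdiff \<epsilon> (\<lambda>y. ereal (\<phi> y)) x)"
proof -
  have "eps_subdiff \<epsilon> (\<lambda>y. ereal (\<phi> y)) x = {s. \<forall>y. \<phi> x + s \<bullet> (y - x) - \<epsilon> \<le> \<phi> y}"
    using mem_eps_subdiff_real by blast
  then show ?thesis
    by (auto intro!: closed_Collect_all closed_Collect_le continuous_intros)
qed

text \<open>An exact subgradient works for every \<open>\<epsilon> \<ge> 0\<close>. Without
  nonemptiness, a bound on \<open>infdist\<close> could hold merely through its default value
  \<open>0\<close>.\<close>

lemma eps_subdiff_real_nonempty:
  assumes "convex_fun (\<lambda>y. ereal (\<phi> y))" "\<epsilon> \<ge> 0"
  shows "eps_subdiff \<epsilon> (\<lambda>y. ereal (\<phi> y)) x \<noteq> {}"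
proof -
  obtain s where s: "\<forall>y. \<phi> y \<ge> \<phi> x + s \<bullet> (y - x)"
    using subgradient_exists[OF convex_on_real_of_convex_fun[OF assms(1)]] by blast
  have "\<phi> x + s \<bullet> (y - x) - \<epsilon> \<le> \<phi> y" for y
    using s[rule_format, of y] assms(2) by linarith
  then have "s \<in> eps_subdiff \<epsilon> (\<lambda>y. ereal (\<phi> y)) x"
    by (simp add: mem_eps_subdiff_real)
  then show ?thesis by blast
qed

text \<open>If \<open>g z\<close> were \<open>\<infinity>\<close>, the left side of the first
  stopping inequality would be \<open>- \<infinity>\<close>, below its real right side.\<close>

lemma stopping_test_finite:
  assumes "stopping_test g \<sigma> l \<theta> \<zeta> x u z" "\<bar>g x\<bar> \<noteq> \<infinity>" "g z \<noteq> - \<infinity>"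
  shows "\<bar>g z\<bar> \<noteq> \<infinity>"
  using assms unfolding stopping_test_def by (cases "g x"; cases "g z") auto

lemma tPLDCA_step_descent:
  fixes h :: "'a::euclidean_space \<Rightarrow> real"
  assumes conv: "convex_fun (\<lambda>y. ereal (h y))"
    and gx: "g x = ereal a" and gz: "g z = ereal b"
    and "\<rho> \<ge> 0" "\<gamma> \<ge> 0" "D \<ge> 0"
    and u: "infdist u (eps_subdiff (\<rho> * D\<^sup>2) (\<lambda>y. ereal (h y)) x) \<le> \<gamma> * D"
    and st: "stopping_test g \<sigma> l \<theta> \<zeta> x u z"
  shows "(b - h z) + (\<gamma> / 2 + \<rho>) * (norm (z - x))\<^sup>2 + ((1 - \<sigma>) / l - \<rho> - \<gamma>) * (norm (z - x))\<^sup>2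
           \<le> (a - h x) + (\<gamma> / 2 + \<rho>) * D\<^sup>2"
proof -
  let ?S = "eps_subdiff (\<rho> * D\<^sup>2) (\<lambda>y. ereal (h y)) x"
  have "?S \<noteq> {}" using conv \<open>\<rho> \<ge> 0\<close> by (intro eps_subdiff_real_nonempty) auto
  then obtain s where s: "s \<in> ?S" "infdist u ?S = dist u s"
    using infdist_attains_inf[OF closed_eps_subdiff_real] by metis
  have 1: "h x + s \<bullet> (z - x) - \<rho> * D\<^sup>2 \<le> h z"
    using s(1) by (simp add: mem_eps_subdiff_real)
  have 2: "(1 - \<sigma>) / l * (norm (z - x))\<^sup>2 \<le> a - b - u \<bullet> (x - z)"
    using st by (simp add: stopping_test_def gx gz)
  have "(s - u) \<bullet> (x - z) \<le> norm (s - u) * norm (x - z)" by (rule norm_cauchy_schwarz)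
  also have "\<dots> \<le> (\<gamma> * D) * norm (x - z)"
    using s(2) u by (intro mult_right_mono) (auto simp: dist_norm norm_minus_commute)
  also have "\<dots> = \<gamma> * (D * norm (z - x))" by (simp add: norm_minus_commute)
  also have "\<dots> \<le> \<gamma> * ((D\<^sup>2 + (norm (z - x))\<^sup>2) / 2)"
    using \<open>\<gamma> \<ge> 0\<close> sum_squares_bound[of D "norm (z - x)"] by (intro mult_left_mono) auto
  finally have 3: "(s - u) \<bullet> (x - z) \<le> \<gamma> * ((D\<^sup>2 + (norm (z - x))\<^sup>2) / 2)" .
  have "s \<bullet> (z - x) = - (s \<bullet> (x - z))" by (simp add: inner_diff_right)
  \<comment> \<open>The squared new step has coefficient
    \<open>(1 - \<sigma>) / l - \<gamma> / 2\<close>, which splits into the energy weight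
    \<open>\<gamma> / 2 + \<rho>\<close> and the surplus
    \<open>(1 - \<sigma>) / l - \<rho> - \<gamma>\<close>.\<close>
  with 1 2 3 show ?thesis by (simp add: inner_diff_left algebra_simps add_divide_distrib)
qed

text \<open>The energy is decreasing and bounded below, so its successive drops tend to
  \<open>0\<close>; they dominate \<open>c\<close> times the squared steps.\<close>

lemma energy_descent_convergence:
  fixes F D :: "nat \<Rightarrow> real"
  assumes "c > 0" "m \<ge> 0"
    and bound: "\<And>k. B \<le> F k"
    and step: "\<And>k. F (Suc k) + m * (D (Suc k))\<^sup>2 + c * (D (Suc k))\<^sup>2 \<le> F k + m * (D k)\<^sup>2"
  shows "decseq (\<lambda>k. F k + m * (D k)\<^sup>2)" "D \<longlonglongrightarrow> 0" "convergent F"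
proof -
  let ?E = "\<lambda>k. F k + m * (D k)\<^sup>2"
  have "?E (Suc k) \<le> ?E k" for k
    using step[of k] mult_nonneg_nonneg[of c "(D (Suc k))\<^sup>2"] \<open>c > 0\<close>
      zero_le_power2[of "D (Suc k)"] by linarith
  then show dec: "decseq ?E" by (intro decseq_SucI)
  moreover have "B \<le> ?E k" for k
    using bound[of k] mult_nonneg_nonneg[of m "(D k)\<^sup>2"] \<open>m \<ge> 0\<close>
      zero_le_power2[of "D k"] by linarith
  ultimately obtain L where L: "?E \<longlonglongrightarrow> L" using decseq_convergent by blast
  have "(\<lambda>k. (?E k - ?E (Suc k)) / c) \<longlonglongrightarrow> (L - L) / c"
    by (intro tendsto_intros L LIMSEQ_Suc[OF L]) (use \<open>c > 0\<close> in auto)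
  then have *: "(\<lambda>k. (?E k - ?E (Suc k)) / c) \<longlonglongrightarrow> 0" by simp
  have "(D (Suc k))\<^sup>2 \<le> (?E k - ?E (Suc k)) / c" for k
    using step[of k] \<open>c > 0\<close> by (simp add: field_simps)
  then have "(\<lambda>k. (D (Suc k))\<^sup>2) \<longlonglongrightarrow> 0"
    by (intro tendsto_sandwich[OF _ _ tendsto_const *]) auto
  then have D2: "(\<lambda>k. (D k)\<^sup>2) \<longlonglongrightarrow> 0" by (rule LIMSEQ_imp_Suc)
  then have "(\<lambda>k. sqrt ((D k)\<^sup>2)) \<longlonglongrightarrow> sqrt 0" by (rule tendsto_real_sqrt)
  then show "D \<longlonglongrightarrow> 0" by (simp add: tendsto_rabs_zero_iff)
  have "(\<lambda>k. ?E k - m * (D k)\<^sup>2) \<longlonglongrightarrow> L - m * 0" by (intro tendsto_intros L D2)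
  then show "convergent F" by (auto simp: convergent_def)
qed

theorem theorem4p6:
  fixes f g g0 h :: "real ^ 'n \<Rightarrow> ereal"
    and C :: "(real ^ 'n) set"
    and T :: "real ^ 'n \<Rightarrow> real ^ 'n \<Rightarrow> real \<Rightarrow> nat \<Rightarrow> real ^ 'n"
    and \<sigma> l \<theta> \<rho> \<gamma> :: real
    and \<zeta> :: "nat \<Rightarrow> real"
    and x :: "int \<Rightarrow> real ^ 'n"
  assumes g: "g \<in> Gamma0" and h: "h \<in> Gamma0"
    and f: "f = (\<lambda>y. g y - h y)"
    and f_bounded_below: "(INF y. f y) > - \<infinity>"
    and dom_h: "edom h = UNIV"
    and g0: "g0 \<in> Gamma0" "edom g0 = UNIV"
    and C: "C \<noteq> {}" "closed C" "convex C"
    and g_eq: "g = (\<lambda>y. g0 y + indicator_inf C y)"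
    and T: "inner_algorithm g T"
    and \<sigma>: "0 < \<sigma>" "\<sigma> < 1"
    and l: "l > 0"
    and \<theta>: "\<theta> > 1 / l"
    and \<rho>: "0 \<le> \<rho>" "\<rho> < (1 - \<sigma>) / l"
    and \<gamma>: "0 \<le> \<gamma>" "\<gamma> < (1 - \<sigma>) / l - \<rho>"
    and \<zeta>: "\<And>k. \<zeta> k > 0" "\<zeta> \<longlonglongrightarrow> 0"
    and x: "tPLDCA g h T \<sigma> l \<theta> \<rho> \<gamma> \<zeta> x"
  shows "decseq (\<lambda>k::nat. f (x (int k)) +
           ereal ((\<gamma> / 2 + \<rho>) * (norm (x (int k) - x (int k - 1)))\<^sup>2)) \<and>
         (\<lambda>k::nat. norm (x (int k + 1) - x (int k))) \<longlonglongrightarrow> 0 \<and>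
         (\<exists>L::real. (\<lambda>k::nat. f (x (int k))) \<longlonglongrightarrow> ereal L)"
proof -
  have h_fin: "\<bar>h y\<bar> \<noteq> \<infinity>" for y
    using h dom_h by (auto simp: Gamma0_def proper_fun_def edom_def less_top)
  define hr where "hr = (\<lambda>y. real_of_ereal (h y))"
  have h_eq: "h = (\<lambda>y. ereal (hr y))" using h_fin by (simp add: hr_def ereal_real)
  have conv: "convex_fun (\<lambda>y. ereal (hr y))" using h h_eq by (simp add: Gamma0_def)
  have g_ninf: "g y \<noteq> - \<infinity>" for y using g by (simp add: Gamma0_def proper_fun_def)
  define D where "D = (\<lambda>k::nat. norm (x (int k) - x (int k - 1)))"
  define c where "c = (1 - \<sigma>) / l - \<rho> - \<gamma>"
  have step: "\<exists>u. infdist u (eps_subdiff (\<rho> * (D k)\<^sup>2) h (x (int k))) \<le> \<gamma> * D k \<and>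
      stopping_test g \<sigma> l \<theta> (\<zeta> k) (x (int k)) u (x (int (Suc k)))" for k
  proof -
    have "int (Suc k) = int k + 1" by simp
    with x show ?thesis unfolding tPLDCA_def D_def by metis
  qed
  have g_fin: "\<bar>g (x (int k))\<bar> \<noteq> \<infinity>" for k
  proof (induction k)
    case 0
    have "g (x 0) - h (x 0) < \<infinity>" using x by (simp add: tPLDCA_def edom_def)
    \<comment> \<open>As \<open>h\<close> is finite, \<open>g (x 0) = \<infinity>\<close> would make
      the difference infinite.\<close>
    then show ?case using g_ninf[of "x 0"] by (cases "g (x 0)") (auto simp: h_eq)
  next
    case (Suc k)
    obtain u where "stopping_test g \<sigma> l \<theta> (\<zeta> k) (x (int k)) u (x (int (Suc k)))"
      using step by blast
    then show ?case using Suc.IH g_ninf by (rule stopping_test_finite)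
  qed
  define F where "F = (\<lambda>k::nat. real_of_ereal (g (x (int k))) - hr (x (int k)))"
  have f_eq: "f (x (int k)) = ereal (F k)" for k
  proof -
    have "g (x (int k)) = ereal (real_of_ereal (g (x (int k))))"
      using g_fin[of k] by (simp add: ereal_real)
    then show ?thesis unfolding f F_def h_eq by (metis ereal_minus(1))
  qed
  \<comment> \<open>A real number strictly below the infimum avoids proving that the infimum itself
    is finite.\<close>
  obtain B where "ereal B < (INF y. f y)"
    using f_bounded_below ereal_dense2 by blast
  then have bound: "B \<le> F k" for k
    by (metis INF_lower UNIV_I ereal_less_eq(3) f_eq less_imp_le order_trans)
  have descent: "F (Suc k) + (\<gamma> / 2 + \<rho>) * (D (Suc k))\<^sup>2 + c * (D (Suc k))\<^sup>2
      \<le> F k + (\<gamma> / 2 + \<rho>) * (D k)\<^sup>2" for k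
  proof -
    obtain u where u: "infdist u (eps_subdiff (\<rho> * (D k)\<^sup>2) h (x (int k))) \<le> \<gamma> * D k"
      "stopping_test g \<sigma> l \<theta> (\<zeta> k) (x (int k)) u (x (int (Suc k)))"
      using step by blast
    have D: "D (Suc k) = norm (x (int (Suc k)) - x (int k))" "D k \<ge> 0" by (simp_all add: D_def)
    have g_real: "g (x (int j)) = ereal (real_of_ereal (g (x (int j))))" for j
      using g_fin[of j] by (simp add: ereal_real)
    show ?thesis
      unfolding F_def c_def D(1)
      by (rule tPLDCA_step_descent[OF conv g_real g_real \<rho>(1) \<gamma>(1) D(2) u(1)[unfolded h_eq] u(2)])
  qed
  have "c > 0" "\<gamma> / 2 + \<rho> \<ge> 0" using \<gamma> \<rho> by (auto simp: c_def)
  note lim = energy_descent_convergence[where F = F and D = D, OF this bound descent]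
  have "decseq (\<lambda>k. f (x (int k)) +
      ereal ((\<gamma> / 2 + \<rho>) * (norm (x (int k) - x (int k - 1)))\<^sup>2))"
    using lim(1) by (simp add: f_eq decseq_def D_def)
  \<comment> \<open>\<open>D k\<close> is the step that leads into \<open>x (int k)\<close>, hence
    the shift by one.\<close>
  moreover have "(\<lambda>k. norm (x (int k + 1) - x (int k))) \<longlonglongrightarrow> 0"
    using LIMSEQ_Suc[OF lim(2)] by (simp add: D_def add.commute)
  moreover have "\<exists>L::real. (\<lambda>k. f (x (int k))) \<longlonglongrightarrow> ereal L"
    using lim(3) by (auto simp: f_eq convergent_def)
  ultimately show ?thesis by blast
qed

end
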